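(* Let $G$ be the star graph on nodes $\{1,\dots,n\}$ with center node $1$ (edges $\{1,i\}$ for $i=2,\dots,n$ and no others). Define $x$ by $x_{1i}=\frac12$ for $i=2,\dots,n$ and $x_{ij}=1$ for all distinct $i,j\in\{2,\dots,n\}$. Then $x$ is an optimal solution of the LambdaPrime LP relaxation of $G$ for every $\lambda\in\left(\frac1{n-1},\frac12\right)$.
   Context: The LambdaPrime LP relaxation of a graph $G=(V,E)$ with parameter $\lambda$ has variables $x_{ij}$ for unordered pairs $i<j$ of nodes: minimize $\sum_{(i,j)\in E}x_{ij}+\sum_{i<j}\lambda(1-x_{ij})$ subject to $x_{ij}\le x_{ik}+x_{jk}$ for all $i,j,k$ and $0\le x_{ij}\le1$. *)

theory Defs
  imports Complex_Main "HOL-Library.Ramsey"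
begin

type_synonym 'a graph = "'a set \<times> 'a set set"

definition simple_graph :: "'a graph \<Rightarrow> bool" where
  "simple_graph G \<longleftrightarrow> finite (fst G) \<and> snd G \<subseteq> [fst G]\<^bsup>2\<^esup>"

(* The LP variable of an unordered pair {i, j} of distinct nodes is x {i, j}, so a candidate
   solution is a function on 2-element sets of nodes; its values on other sets play no role. *)

definition lambda_prime_feasible :: "'a graph \<Rightarrow> ('a set \<Rightarrow> real) \<Rightarrow> bool" where
  "lambda_prime_feasible G x \<longleftrightarrow>
     (\<forall>i\<in>fst G. \<forall>j\<in>fst G. \<forall>k\<in>fst G.
        i \<noteq> j \<and> i \<noteq> k \<and> j \<noteq> k \<longrightarrow> x {i, j} \<le> x {i, k} + x {j, k}) \<and>
     (\<forall>i\<in>fst G. \<forall>j\<in>fst G. i \<noteq> j \<longrightarrow> 0 \<le> x {i, j} \<and> x {i, j} \<le> 1)"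

definition lambda_prime_objective :: "'a graph \<Rightarrow> real \<Rightarrow> ('a set \<Rightarrow> real) \<Rightarrow> real" where
  "lambda_prime_objective G lam x = (\<Sum>e\<in>snd G. x e) + (\<Sum>p\<in>[fst G]\<^bsup>2\<^esup>. lam * (1 - x p))"

definition lambda_prime_optimal :: "'a graph \<Rightarrow> real \<Rightarrow> ('a set \<Rightarrow> real) \<Rightarrow> bool" where
  "lambda_prime_optimal G lam x \<longleftrightarrow>
     is_arg_min (lambda_prime_objective G lam) (lambda_prime_feasible G) x"

definition star_graph :: "nat \<Rightarrow> nat graph" where
  "star_graph n = ({1..n}, {{1, i} | i. i \<in> {2..n}})"

lemma simple_graph_star_graph: "simple_graph (star_graph n)"
  by (auto simp: simple_graph_def star_graph_def nsets_def)

end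

theory Submission
  imports Defs
begin

text \<open>
  Write \<open>A = {2..n}\<close> for the leaves, \<open>m = n - 1\<close>, \<open>y i = x {1, i}\<close>. By the triangle inequality and
  the bound \<open>x \<le> 1\<close>, each pair of leaves contributes at least \<open>w (1 - y i - y j)\<close> to the objective
  for every \<open>0 \<le> w \<le> lam\<close>. The dual solution giving all these constraints the same weight
  \<open>w = (1 - lam) / (m - 1)\<close>, which satisfies \<open>w \<le> lam\<close> exactly because \<open>lam \<ge> 1 / m\<close>, cancels the
  \<open>y i\<close> altogether and leaves the lower bound \<open>m (1 + lam) / 2\<close>, attained by the given solution.
\<close>

text \<open>Double counting: each element of \<open>A\<close> lies in exactly
  \<open>card A - 1\<close> pairs. This is how bounds summed over pairs of leaves become a multiple
  of a sum over leaves.\<close>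

lemma sum_nsets_2:
  fixes f :: "'a \<Rightarrow> real"
  assumes "finite A"
  shows "(\<Sum>p\<in>[A]\<^bsup>2\<^esup>. \<Sum>i\<in>p. f i) = (real (card A) - 1) * (\<Sum>i\<in>A. f i)"
proof -
  have pairs: "{p \<in> [A]\<^bsup>2\<^esup>. i \<in> p} = (\<lambda>j. {i, j}) ` (A - {i})" if "i \<in> A" for i
    using that by (auto simp: nsets_def card_2_iff)
  have card_pairs: "real (card {p \<in> [A]\<^bsup>2\<^esup>. i \<in> p}) = real (card A) - 1" if "i \<in> A" for i
  proof -
    have "inj_on (\<lambda>j. {i, j}) (A - {i})"
      by (auto simp: inj_on_def doubleton_eq_iff)
    moreover have "card A \<ge> 1"
      using that assms by (metis One_nat_def Suc_leI card_gt_0_iff empty_iff)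
    ultimately show ?thesis
      using that assms by (simp add: pairs card_image of_nat_diff)
  qed
  have "(\<Sum>p\<in>[A]\<^bsup>2\<^esup>. \<Sum>i\<in>p. f i) = (\<Sum>p\<in>[A]\<^bsup>2\<^esup>. \<Sum>i | i \<in> A \<and> i \<in> p. f i)"
    by (intro sum.cong refl) (auto simp: nsets_def)
  also have "\<dots> = (\<Sum>i\<in>A. \<Sum>p | p \<in> [A]\<^bsup>2\<^esup> \<and> i \<in> p. f i)"
    using assms by (intro sum.swap_restrict) (auto simp: finite_imp_finite_nsets)
  also have "\<dots> = (\<Sum>i\<in>A. (real (card A) - 1) * f i)"
    using card_pairs by (intro sum.cong refl) simp
  finally show ?thesis
    by (simp add: sum_distrib_left)
qed

text \<open>The pairs of nodes are the edges at the center and the pairs of leaves. An edge is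
  counted in both sums of the objective, and its two terms merge into one affine term.\<close>

lemma objective_star_graph:
  "lambda_prime_objective (star_graph n) lam z =
     (\<Sum>i\<in>{2..n}. (1 - lam) * z {1, i} + lam) + lam * (\<Sum>p\<in>[{2..n}]\<^bsup>2\<^esup>. 1 - z p)"
proof -
  let ?E = "(\<lambda>i. {1, i}) ` {2..n}"
  have edges: "snd (star_graph n) = ?E" and nodes: "fst (star_graph n) = {1..n}"
    by (auto simp: star_graph_def)
  have split: "[{1..n}]\<^bsup>2\<^esup> = ?E \<union> [{2..n}]\<^bsup>2\<^esup>"
  proof (intro equalityI subsetI)
    fix p assume "p \<in> [{1..n}]\<^bsup>2\<^esup>"
    then obtain a b where p: "p = {a, b}" "a \<noteq> b" "a \<in> {1..n}" "b \<in> {1..n}"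
      by (auto simp: nsets_def card_2_iff)
    consider "a = 1" | "b = 1" | "a \<noteq> 1" "b \<noteq> 1" by blast
    then show "p \<in> ?E \<union> [{2..n}]\<^bsup>2\<^esup>"
      using p by cases (auto simp: nsets_def insert_commute)
  qed (auto simp: nsets_def)
  have disj: "?E \<inter> [{2..n}]\<^bsup>2\<^esup> = {}"
    by (auto simp: nsets_def)
  have inj: "inj_on (\<lambda>i. {1, i}) {2..n}"
    by (auto simp: inj_on_def doubleton_eq_iff)
  have "(\<Sum>p\<in>[{1..n}]\<^bsup>2\<^esup>. lam * (1 - z p)) =
      (\<Sum>i\<in>{2..n}. lam * (1 - z {1, i})) + (\<Sum>p\<in>[{2..n}]\<^bsup>2\<^esup>. lam * (1 - z p))"
    unfolding split using inj disj
    by (subst sum.union_disjoint) (auto simp: sum.reindex finite_imp_finite_nsets)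
  moreover have "(\<Sum>p\<in>?E. z p) = (\<Sum>i\<in>{2..n}. z {1, i})"
    using inj by (simp add: sum.reindex)
  ultimately show ?thesis
    unfolding lambda_prime_objective_def edges nodes
    by (simp add: sum_distrib_left sum.distrib algebra_simps sum_subtractf)
qed

lemma objective_star_graph_ge:
  assumes feas: "lambda_prime_feasible (star_graph n) z"
    and m: "m = real n - 1" "m > 1" and lam: "1 / m \<le> lam" "lam \<le> 1"
  shows "lambda_prime_objective (star_graph n) lam z \<ge> m * (1 + lam) / 2"
proof -
  define w where "w = (1 - lam) / (m - 1)"
  define S where "S = (\<Sum>i\<in>{2..n}. z {1, i})"
  \<comment> \<open>Clearing the denominator \<open>m - 1 > 0\<close>, the second claim becomes
    \<open>1 <= lam * m\<close>.\<close>
  have w: "0 \<le> w" "w \<le> lam" "w * (m - 1) = 1 - lam"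
    using m lam by (auto simp: w_def field_simps)
  have card: "real (card {2..n}) = m"
    using m by (simp add: of_nat_diff)
  \<comment> \<open>Splitting the constant 1 into two halves makes the lower bound a sum over the
    members of \<open>p\<close>, the form that \<open>sum_nsets_2\<close> handles.\<close>
  have pair: "w * (\<Sum>i\<in>p. 1 / 2 - z {1, i}) \<le> lam * (1 - z p)" if "p \<in> [{2..n}]\<^bsup>2\<^esup>" for p
  proof -
    obtain a b where p: "p = {a, b}" "a \<noteq> b" "a \<in> {2..n}" "b \<in> {2..n}"
      using \<open>p \<in> _\<close> by (auto simp: nsets_def card_2_iff)
    have "\<forall>i\<in>{1..n}. \<forall>j\<in>{1..n}. \<forall>k\<in>{1..n}.
        i \<noteq> j \<and> i \<noteq> k \<and> j \<noteq> k \<longrightarrow> z {i, j} \<le> z {i, k} + z {j, k}"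
      and "\<forall>i\<in>{1..n}. \<forall>j\<in>{1..n}. i \<noteq> j \<longrightarrow> 0 \<le> z {i, j} \<and> z {i, j} \<le> 1"
      using feas by (auto simp: lambda_prime_feasible_def star_graph_def)
    \<comment> \<open>The triangle inequality through the center gives the bound with weight
      \<open>w\<close>; \<open>z p \<le> 1\<close> then allows raising \<open>w\<close> to
      \<open>lam\<close>.\<close>
    from this(1)[rule_format, of a b 1] this(2)[rule_format, of a b]
    have "z p \<le> z {1, a} + z {1, b}" "z p \<le> 1"
      using p by (auto simp: insert_commute)
    then have "w * (\<Sum>i\<in>p. 1 / 2 - z {1, i}) \<le> w * (1 - z p)" "w * (1 - z p) \<le> lam * (1 - z p)"
      using p w by (auto intro!: mult_left_mono mult_right_mono)
    then show ?thesis by linarith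
  qed
  have "lambda_prime_objective (star_graph n) lam z =
      (1 - lam) * S + lam * m + (\<Sum>p\<in>[{2..n}]\<^bsup>2\<^esup>. lam * (1 - z p))"
    unfolding objective_star_graph
    using card by (simp add: S_def sum.distrib sum_distrib_left)
  also have "\<dots> \<ge> (1 - lam) * S + lam * m + (\<Sum>p\<in>[{2..n}]\<^bsup>2\<^esup>. w * (\<Sum>i\<in>p. 1 / 2 - z {1, i}))"
    by (intro add_left_mono sum_mono pair)
  also have "(\<Sum>p\<in>[{2..n}]\<^bsup>2\<^esup>. w * (\<Sum>i\<in>p. 1 / 2 - z {1, i})) = w * ((m - 1) * (m / 2 - S))"
    unfolding sum_distrib_left[symmetric] sum_nsets_2[OF finite_atLeastAtMost] card
    using card by (simp add: sum_subtractf S_def)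
  \<comment> \<open>Here \<open>S\<close> cancels against the edge terms.\<close>
  also have "\<dots> = (1 - lam) * (m / 2 - S)"
    using w(3) by (metis mult.assoc)
  finally show ?thesis
    by (simp add: field_simps)
qed

theorem theorem8:
  fixes n :: nat and lam :: real and x :: "nat set \<Rightarrow> real"
  assumes "n \<ge> 2"
    and "\<And>i. i \<in> {2..n} \<Longrightarrow> x {1, i} = 1 / 2"
    and "\<And>i j. i \<in> {2..n} \<Longrightarrow> j \<in> {2..n} \<Longrightarrow> i \<noteq> j \<Longrightarrow> x {i, j} = 1"
    and "lam \<in> {1 / (real n - 1) <..< 1 / 2}"
  shows "lambda_prime_optimal (star_graph n) lam x"
proof -
  define m where "m = real n - 1"
  have lam: "1 / m < lam" "lam < 1 / 2"
    using assms(4) by (auto simp: m_def)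
  have "m > 0"
    using assms(1) by (simp add: m_def)
  \<comment> \<open>The interval for \<open>lam\<close> is nonempty, which rules out
    \<open>n = 2\<close>.\<close>
  moreover have "1 / m < 1 / 2"
    using lam by linarith
  ultimately have "m > 1"
    by (simp add: field_simps)
  have x: "x {i, j} = (if i = 1 \<or> j = 1 then 1 / 2 else 1)"
    if "i \<in> {1..n}" "j \<in> {1..n}" "i \<noteq> j" for i j
  proof -
    consider "i = 1" | "j = 1" | "i \<noteq> 1" "j \<noteq> 1" by blast
    then show ?thesis
      using that assms(2)[of i] assms(2)[of j] assms(3)[of i j]
      by cases (auto simp: insert_commute)
  qed
  \<comment> \<open>Among three distinct nodes at most one is the center, so each triangle
    inequality reads 1 \<le> 1/2 + 1/2, 1/2 \<le> 1/2 + 1 or 1 \<le> 1 + 1.\<close>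
  have "lambda_prime_feasible (star_graph n) x"
    using x by (auto simp: lambda_prime_feasible_def star_graph_def)
  moreover have "lambda_prime_objective (star_graph n) lam x = m * (1 + lam) / 2"
  proof -
    have "(\<Sum>i\<in>{2..n}. (1 - lam) * x {1, i} + lam) = (\<Sum>i\<in>{2..n}. (1 + lam) / 2)"
      using assms(2) by (intro sum.cong refl) (simp add: field_simps)
    moreover have "(\<Sum>p\<in>[{2..n}]\<^bsup>2\<^esup>. 1 - x p) = 0"
      using assms(3) by (intro sum.neutral) (auto simp: nsets_def card_2_iff)
    ultimately show ?thesis
      using assms(1) by (simp add: objective_star_graph m_def of_nat_diff)
  qed
  moreover have "m * (1 + lam) / 2 \<le> lambda_prime_objective (star_graph n) lam z"
    if "lambda_prime_feasible (star_graph n) z" for z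
    using objective_star_graph_ge[OF that m_def \<open>m > 1\<close>, of lam] lam by simp
  ultimately show ?thesis
    unfolding lambda_prime_optimal_def is_arg_min_linorder by metis
qed

end
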